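(* Let $\Theta$ be any non-empty finite parameter space, let $\mathcal I$ be the set of all (coded, finite, effective) inference bases with parameter space $\Theta$, let $L,C\subseteq\mathcal I\times\mathcal I$ be the likelihood and conditionality relations, and let $\mathcal A$ be a set. If a statistical procedure $Ev\subseteq\mathcal I\times\mathcal A$ preserves $C$, then $Ev(I_1)=Ev(I_2)$ for each $(I_1,I_2)\in L\setminus C$.
   Context: **Models and inference bases.** Fix a non-empty finite set $\Theta$ and work in a fixed set-theoretic universe. A statistical model $E$ consists of a finite non-empty sample space $\mathcal X_E$, a family of probability mass functions $f_{E,\theta}$ on $\mathcal X_E$ ($\theta\in\Theta$), and an injective outcome code $c_E:\mathcal X_E\to\mathbb N$, such that every outcome is effective: for each $x\in\mathcal X_E$ there is $\theta\in\Theta$ with $f_{E,\theta}(x)>0$. Write $\mathbb P_{E,\theta}$ for the probability with mass function $f_{E,\theta}$. An inference base is a pair $I=(E,x)$ with $x\in\mathcal X_E$; $\mathcal I$ is the set of all inference bases with parameter space $\Theta$. Below $I_i=(E_i,x_i)$. **Likelihood relation.** $(I_1,I_2)\in L$ iff there is $k>0$ with $f_{E_1,\theta}(x_1)=k f_{E_2,\theta}(x_2)$ for all $\theta\in\Theta$. **Conditionality relation.** A statistic $A:\mathcal X_E\to\mathcal A_0$ is ancillary for $E$ if its distribution under $\mathbb P_{E,\theta}$ does not depend on $\theta$. Say $I_1\to I_2$ if there are an ancillary statistic $A:\mathcal X_{E_1}\to\mathcal A_0$ for $E_1$ with, for $a=A(x_1)$, $\mathbb P_{E_1,\theta}(A=a)>0$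 for every $\theta$, and an injection $\iota:\mathcal X_{E_2}\to\mathcal X_{E_1}$ with image exactly $A^{-1}\{a\}$, $\iota(x_2)=x_1$, and $f_{E_2,\theta}(y)=f_{E_1,\theta}(\iota(y))/\mathbb P_{E_1,\theta}(A=a)$ for all $\theta\in\Theta$, $y\in\mathcal X_{E_2}$, such that at least one of the following holds: (ordinary branch) $c_{E_1}(\iota(y))=c_{E_2}(y)$ for every $y\in\mathcal X_{E_2}$; (mixed-experiment branch) $A$ is surjective onto $\mathcal A_0$ and $\mathcal A_0$ has at least two elements (no condition on codes). Then $(I_1,I_2)\in C$ iff $I_1\to I_2$ or $I_2\to I_1$. **Procedures.** A statistical procedure with codomain $\mathcal A$ is any relation $Ev\subseteq\mathcal I\times\mathcal A$; its output set at $I$ is $Ev(I)=\{a\in\mathcal A:(I,a)\in Ev\}$, which may be empty. $Ev$ preserves $D\subseteq\mathcal I\times\mathcal I$ if $(I_1,I_2)\in D$ implies $Ev(I_1)=Ev(I_2)$. *)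

theory Defs
  imports "HOL-Probability.Probability"
begin

text \<open>
  The parameter space is a type \<open>'th\<close> of class \<^class>\<open>finite\<close>, which is automatically non-empty.
  The type \<open>'x\<close> stands for the fixed set-theoretic universe: sample spaces, and also the
  codomains of statistics, are sets of elements of \<open>'x\<close>. Theorems assume it to be infinite, as
  any such universe is.
\<close>

record ('x, 'th) model =
  sample_space :: "'x set"
  distr_of :: "'th \<Rightarrow> 'x pmf"
  outcome_code :: "'x \<Rightarrow> nat"

abbreviation mass :: "('x, 'th) model \<Rightarrow> 'th \<Rightarrow> 'x \<Rightarrow> real"
  where "mass E \<theta> x \<equiv> pmf (distr_of E \<theta>) x"

abbreviation prob_of :: "('x, 'th) model \<Rightarrow> 'th \<Rightarrow> 'x set \<Rightarrow> real"
  where "prob_of E \<theta> S \<equiv> measure_pmf.prob (distr_of E \<theta>) S"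

text \<open>
  The code is a function on the sample space only; \<^const>\<open>extensional\<close> fixes its values elsewhere,
  so that equality of records is equality of models.
\<close>

definition statistical_model :: "('x, 'th::finite) model \<Rightarrow> bool" where
  "statistical_model E \<longleftrightarrow>
     finite (sample_space E) \<and> sample_space E \<noteq> {} \<and>
     (\<forall>\<theta>. set_pmf (distr_of E \<theta>) \<subseteq> sample_space E) \<and>
     outcome_code E \<in> extensional (sample_space E) \<and>
     inj_on (outcome_code E) (sample_space E) \<and>
     (\<forall>x\<in>sample_space E. \<exists>\<theta>. mass E \<theta> x > 0)"

type_synonym ('x, 'th) inference_base = "('x, 'th) model \<times> 'x"

definition inference_bases :: "('x, 'th::finite) inference_base set" where
  "inference_bases = {(E, x). statistical_model E \<and> x \<in> sample_space E}"

definition likelihood_rel ::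
    "(('x, 'th::finite) inference_base \<times> ('x, 'th) inference_base) set" where
  "likelihood_rel = {((E1, x1), (E2, x2)).
     (E1, x1) \<in> inference_bases \<and> (E2, x2) \<in> inference_bases \<and>
     (\<exists>k>0. \<forall>\<theta>. mass E1 \<theta> x1 = k * mass E2 \<theta> x2)}"

definition ancillary :: "('x, 'th::finite) model \<Rightarrow> ('x \<Rightarrow> 'b) \<Rightarrow> 'b set \<Rightarrow> bool" where
  "ancillary E A A0 \<longleftrightarrow>
     A \<in> sample_space E \<rightarrow> A0 \<and>
     (\<forall>\<theta> \<theta>'. map_pmf A (distr_of E \<theta>) = map_pmf A (distr_of E \<theta>'))"

text \<open>
  Taking \<open>A0\<close> inside \<open>'x\<close> loses nothing: in the mixed-experiment branch (the last disjunct)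
  \<open>A0\<close> is the image of the sample space and so embeds in \<open>'x\<close>, and in the ordinary branch any
  \<open>A0\<close> may be replaced by that image.
\<close>

definition cond_step ::
    "('x, 'th::finite) inference_base \<Rightarrow> ('x, 'th) inference_base \<Rightarrow> bool" where
  "cond_step = (\<lambda>(E1, x1) (E2, x2).
     \<exists>(A :: 'x \<Rightarrow> 'x) (A0 :: 'x set) (\<iota> :: 'x \<Rightarrow> 'x).
       let fibre = {x \<in> sample_space E1. A x = A x1} in
       ancillary E1 A A0 \<and>
       (\<forall>\<theta>. prob_of E1 \<theta> fibre > 0) \<and>
       inj_on \<iota> (sample_space E2) \<and> \<iota> ` sample_space E2 = fibre \<and> \<iota> x2 = x1 \<and>
       (\<forall>\<theta>. \<forall>y\<in>sample_space E2. mass E2 \<theta> y = mass E1 \<theta> (\<iota> y) / prob_of E1 \<theta> fibre) \<and>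
       ((\<forall>y\<in>sample_space E2. outcome_code E1 (\<iota> y) = outcome_code E2 y) \<or>
        (A ` sample_space E1 = A0 \<and> (\<exists>a\<in>A0. \<exists>b\<in>A0. a \<noteq> b))))"

definition conditionality_rel ::
    "(('x, 'th::finite) inference_base \<times> ('x, 'th) inference_base) set" where
  "conditionality_rel = {(I1, I2).
     I1 \<in> inference_bases \<and> I2 \<in> inference_bases \<and> (cond_step I1 I2 \<or> cond_step I2 I1)}"

definition statistical_procedure ::
    "'a set \<Rightarrow> (('x, 'th::finite) inference_base \<times> 'a) set \<Rightarrow> bool" where
  "statistical_procedure \<A> Ev \<longleftrightarrow> Ev \<subseteq> inference_bases \<times> \<A>"

definition output_set ::
    "'a set \<Rightarrow> (('x, 'th::finite) inference_base \<times> 'a) set \<Rightarrow> ('x, 'th) inference_base \<Rightarrow> 'a set"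
  where "output_set \<A> Ev I = {a \<in> \<A>. (I, a) \<in> Ev}"

definition preserves ::
    "'a set \<Rightarrow> (('x, 'th::finite) inference_base \<times> 'a) set \<Rightarrow>
     (('x, 'th) inference_base \<times> ('x, 'th) inference_base) set \<Rightarrow> bool" where
  "preserves \<A> Ev D \<longleftrightarrow> (\<forall>(I1, I2)\<in>D. output_set \<A> Ev I1 = output_set \<A> Ev I2)"

end

theory Submission
  imports Defs
begin

text \<open>
  In a two-point model only the likelihood of the observed point matters, so it suffices to link
  every inference base, by conditionality steps, to a two-point base that carries the same
  likelihood up to a prescribed factor. Two bases with proportional likelihoods can then be linked
  to one and the same two-point base, and a procedure that preserves conditionality gives the same
  output along the whole chain.

  To link \<open>(E, x)\<close> to the two-point base whose observed point has mass \<open>c f(x)\<close>, where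
  \<open>0 < c < 1\<close> and \<open>f\<close> is the mass function of \<open>E\<close>, add two fresh outcomes \<open>z\<close> and \<open>w\<close> to \<open>E\<close> and
  distribute the mass as follows:
  \<^item> \<open>c f(y) / 2\<close> on each outcome \<open>y\<close> of \<open>E\<close>,
  \<^item> \<open>(1 - c f(x)) / 2\<close> on \<open>z\<close>,
  \<^item> \<open>(1 - c + c f(x)) / 2\<close> on \<open>w\<close>.
  The old sample space has probability \<open>c / 2\<close> and the pair \<open>{x, z}\<close> has probability \<open>1 / 2\<close>,
  whatever the parameter. Both events are therefore fibres of a two-valued ancillary. Conditioning
  on the first gives back \<open>(E, x)\<close>; conditioning on the second gives the two-point base. Since \<open>w\<close>
  lies in neither event, both ancillaries really take two values, so that the mixed-experiment
  branch applies and the outcome codes can be ignored.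

  If \<open>f\<^sub>1(x\<^sub>1) = k f\<^sub>2(x\<^sub>2)\<close>, the factors \<open>1 / (1 + k)\<close> for the first base and \<open>k / (1 + k)\<close> for the
  second lead to the same two-point base.
\<close>

section \<open>Finite models with prescribed masses\<close>

text \<open>
  The choice of code is immaterial; \<^const>\<open>to_nat_on\<close> is some injection of the countable set \<open>S\<close>.
\<close>

definition model_of_masses :: "'x set \<Rightarrow> ('th \<Rightarrow> 'x \<Rightarrow> real) \<Rightarrow> ('x, 'th) model" where
  "model_of_masses S g =
     \<lparr>sample_space = S,
      distr_of = (\<lambda>\<theta>. embed_pmf (\<lambda>x. if x \<in> S then g \<theta> x else 0)),
      outcome_code = restrict (to_nat_on S) S\<rparr>"

lemma sample_space_model_of_masses [simp]: "sample_space (model_of_masses S g) = S"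
  by (simp add: model_of_masses_def)

lemma mass_model_of_masses:
  assumes "finite S" and nonneg: "\<And>x. x \<in> S \<Longrightarrow> 0 \<le> g \<theta> x" and total: "sum (g \<theta>) S = 1"
  shows "mass (model_of_masses S g) \<theta> x = (if x \<in> S then g \<theta> x else 0)"
proof -
  let ?h = "\<lambda>x. if x \<in> S then g \<theta> x else 0"
  have "(\<integral>\<^sup>+x. ennreal (?h x) \<partial>count_space UNIV) = (\<Sum>x\<in>S. ennreal (?h x))"
    using \<open>finite S\<close> by (intro nn_integral_count_space') auto
  also have "\<dots> = ennreal (\<Sum>x\<in>S. ?h x)"
    using nonneg by (intro sum_ennreal) auto
  also have "\<dots> = 1"
    using total by simp
  finally have "pmf (embed_pmf ?h) x = ?h x"
    using nonneg by (intro pmf_embed_pmf) auto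
  then show ?thesis
    by (simp add: model_of_masses_def)
qed

lemma statistical_model_of_masses:
  fixes g :: "'th::finite \<Rightarrow> 'x \<Rightarrow> real"
  assumes "finite S" "S \<noteq> {}"
    and nonneg: "\<And>\<theta> x. x \<in> S \<Longrightarrow> 0 \<le> g \<theta> x" and total: "\<And>\<theta>. sum (g \<theta>) S = 1"
    and effective: "\<And>x. x \<in> S \<Longrightarrow> \<exists>\<theta>. 0 < g \<theta> x"
  shows "statistical_model (model_of_masses S g)"
proof -
  note mass = mass_model_of_masses[of S g, OF \<open>finite S\<close> nonneg total]
  have "set_pmf (distr_of (model_of_masses S g) \<theta>) \<subseteq> S" for \<theta>
    by (auto simp: set_pmf_iff mass split: if_splits)
  moreover have "inj_on (to_nat_on S) S"
    using \<open>finite S\<close> by (intro inj_on_to_nat_on countable_finite)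
  then have "inj_on (outcome_code (model_of_masses S g)) S"
    by (simp add: model_of_masses_def inj_on_def)
  moreover have "outcome_code (model_of_masses S g) \<in> extensional S"
    by (simp add: model_of_masses_def)
  ultimately show ?thesis
    using assms by (auto simp: statistical_model_def mass)
qed

lemma sum_mass_sample_space:
  assumes "statistical_model E"
  shows "sum (mass E \<theta>) (sample_space E) = 1"
  using assms by (intro sum_pmf_eq_1) (auto simp: statistical_model_def)

lemma prob_of_finite:
  assumes "statistical_model E" "F \<subseteq> sample_space E"
  shows "prob_of E \<theta> F = sum (mass E \<theta>) F"
  using assms by (intro measure_measure_pmf_finite)
    (auto simp: statistical_model_def intro: finite_subset)

section \<open>Conditioning on an event of constant probability\<close>

text \<open>
  The indicator of an event is ancillary as soon as the probability of the event is the same for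
  all parameters; a proper event makes the indicator two-valued, which is the mixed-experiment
  branch.
\<close>

lemma cond_step_event:
  fixes E1 E2 :: "('x, 'th::finite) model"
  assumes E1: "statistical_model E1"
    and F: "F \<subset> sample_space E1" and x1: "x1 \<in> F"
    and const: "\<And>\<theta>. prob_of E1 \<theta> F = q" and "0 < q"
    and \<iota>: "inj_on \<iota> (sample_space E2)" "\<iota> ` sample_space E2 = F" "\<iota> x2 = x1"
    and mass: "\<And>\<theta> y. y \<in> sample_space E2 \<Longrightarrow> mass E2 \<theta> y = mass E1 \<theta> (\<iota> y) / q"
  shows "cond_step (E1, x1) (E2, x2)"
proof -
  obtain d where d: "d \<in> sample_space E1" "d \<notin> F"
    using F by blast
  \<comment> \<open>The two values of the indicator have to be elements of the universe: \<open>x1\<close> and \<open>d\<close> serve.\<close>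
  define A where "A = (\<lambda>y. if y \<in> F then x1 else d)"
  have "x1 \<noteq> d"
    using x1 d by blast
  have fibre: "{x \<in> sample_space E1. A x = A x1} = F"
    using F x1 \<open>x1 \<noteq> d\<close> by (auto simp: A_def)
  have image: "A ` sample_space E1 = {x1, d}"
    using F x1 d by (auto simp: A_def)
  have "map_pmf A (distr_of E1 \<theta>) = map_pmf A (distr_of E1 \<theta>')" for \<theta> \<theta>'
  proof (rule pmf_eqI)
    fix v
    have compl: "prob_of E1 \<theta>'' (- F) = 1 - q" for \<theta>''
      using measure_pmf.prob_compl[of F "distr_of E1 \<theta>''"] const by (simp add: Compl_eq_Diff_UNIV)
    have "A -` {v} = (if v = x1 then F else if v = d then - F else {})"
      using \<open>x1 \<noteq> d\<close> by (auto simp: A_def)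
    then show "pmf (map_pmf A (distr_of E1 \<theta>)) v = pmf (map_pmf A (distr_of E1 \<theta>')) v"
      by (simp add: pmf_map const compl)
  qed
  then have "ancillary E1 A {x1, d}"
    using image by (auto simp: ancillary_def)
  then show ?thesis
    unfolding cond_step_def prod.case Let_def
    using image \<open>x1 \<noteq> d\<close> \<open>0 < q\<close> \<iota> mass
    by (intro exI[where x = A], unfold fibre const) blast
qed

section \<open>Linking a base to a two-point base\<close>

definition two_point_model :: "'x \<Rightarrow> 'x \<Rightarrow> ('th \<Rightarrow> real) \<Rightarrow> ('x, 'th) model" where
  "two_point_model b b' p = model_of_masses {b, b'} (\<lambda>\<theta> y. if y = b then p \<theta> else 1 - p \<theta>)"

text \<open>
  The witness \<open>J\<close> is the extension of \<open>E\<close> by the fresh outcomes \<open>z\<close> and \<open>w\<close>, observed at \<open>x\<close>. The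
  bound \<open>c < 1\<close> gives \<open>z\<close>, \<open>w\<close> and the second point \<open>b'\<close> of the two-point model a positive mass
  whatever the likelihood of \<open>x\<close>, so that all three are effective.
\<close>

lemma two_point_link:
  fixes E :: "('x, 'th::finite) model"
  assumes universe: "infinite (UNIV :: 'x set)"
    and base: "(E, x) \<in> inference_bases" and c: "0 < c" "c < 1" and "b \<noteq> b'"
  shows "\<exists>J. (J, E, x) \<in> conditionality_rel \<and>
             (J, two_point_model b b' (\<lambda>\<theta>. c * mass E \<theta> x), b) \<in> conditionality_rel"
proof -
  let ?X = "sample_space E"
  have E: "statistical_model E" and x: "x \<in> ?X"
    using base by (auto simp: inference_bases_def)
  have fin: "finite ?X" and eff: "\<And>y. y \<in> ?X \<Longrightarrow> \<exists>\<theta>. 0 < mass E \<theta> y"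
    using E by (auto simp: statistical_model_def)
  obtain z where z: "z \<notin> ?X"
    using ex_new_if_finite[OF universe fin] by blast
  obtain w where w: "w \<notin> insert z ?X"
    using ex_new_if_finite[OF universe, of "insert z ?X"] fin by blast
  have neq: "x \<noteq> z" "x \<noteq> w" "z \<noteq> w"
    using x z w by auto
  have below1: "c * mass E \<theta> x < 1" for \<theta>
  proof -
    have "c * mass E \<theta> x \<le> c * 1"
      using c pmf_le_1 by (intro mult_left_mono) auto
    then show ?thesis
      using c by linarith
  qed

  define S where "S = insert w (insert z ?X)"
  define g where "g = (\<lambda>\<theta> y. if y = z then (1 - c * mass E \<theta> x) / 2
     else if y = w then (1 - c + c * mass E \<theta> x) / 2 else c * mass E \<theta> y / 2)"
  have g_old: "g \<theta> y = c * mass E \<theta> y / 2" if "y \<in> ?X" for \<theta> y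
    using that z w by (auto simp: g_def)
  have sum_old: "sum (g \<theta>) ?X = c / 2" for \<theta>
  proof -
    have "sum (g \<theta>) ?X = c / 2 * sum (mass E \<theta>) ?X"
      by (simp add: g_old sum_distrib_left)
    then show ?thesis
      by (simp add: sum_mass_sample_space[OF E])
  qed
  have pos_new: "0 < g \<theta> z" "0 < g \<theta> w" for \<theta>
    using below1[of \<theta>] c neq by (auto simp: g_def intro!: add_pos_nonneg)
  have finS: "finite S" "S \<noteq> {}"
    using fin by (auto simp: S_def)
  have nonneg: "0 \<le> g \<theta> y" if "y \<in> S" for \<theta> y
    using that pos_new[of \<theta>] c by (auto simp: S_def g_old less_imp_le)
  have total: "sum (g \<theta>) S = 1" for \<theta>
    using fin z w neq by (simp add: S_def sum_old) (simp add: g_def field_simps)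
  have effective: "\<exists>\<theta>. 0 < g \<theta> y" if "y \<in> S" for y
    using that pos_new eff[of y] c by (auto simp: S_def g_old zero_less_mult_iff)
  define M where "M = model_of_masses S g"
  have M: "statistical_model M"
    unfolding M_def by (rule statistical_model_of_masses[OF finS nonneg total effective])
  have space_M: "sample_space M = S"
    by (simp add: M_def)
  have mass_M: "mass M \<theta> y = g \<theta> y" if "y \<in> S" for \<theta> y
    using mass_model_of_masses[of S g \<theta> y, OF finS(1) nonneg total] that by (simp add: M_def)
  have prob_M: "prob_of M \<theta> F = sum (g \<theta>) F" if "F \<subseteq> S" for F \<theta>
    using that by (simp add: prob_of_finite[OF M] space_M mass_M subset_iff)

  have step_E: "cond_step (M, x) (E, x)"
  proof (rule cond_step_event[where F = ?X and q = "c / 2" and \<iota> = "\<lambda>y. y"])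
    show "?X \<subset> sample_space M"
      using z by (auto simp: space_M S_def)
    show "prob_of M \<theta> ?X = c / 2" for \<theta>
      by (subst prob_M) (auto simp: S_def sum_old)
    show "mass E \<theta> y = mass M \<theta> y / (c / 2)" if "y \<in> ?X" for \<theta> y
      using that c mass_M[of y \<theta>] by (simp add: S_def g_old)
  qed (use M x c in auto)

  define p where "p = (\<lambda>\<theta>. c * mass E \<theta> x)"
  let ?h = "\<lambda>\<theta> y. if y = b then p \<theta> else 1 - p \<theta>"
  have p: "0 \<le> p \<theta>" "p \<theta> < 1" for \<theta>
    using c below1 by (auto simp: p_def)
  have p_pos: "\<exists>\<theta>. 0 < p \<theta>"
    using eff[OF x] c by (auto simp: p_def zero_less_mult_iff)
  have h: "0 \<le> ?h \<theta> y" "sum (?h \<theta>) {b, b'} = 1" for \<theta> y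
    using p[of \<theta>] \<open>b \<noteq> b'\<close> by auto
  have h_eff: "\<exists>\<theta>. 0 < ?h \<theta> y" for y
    using p(2) p_pos by auto
  define B where "B = two_point_model b b' p"
  have B: "statistical_model B"
    unfolding B_def two_point_model_def
    by (rule statistical_model_of_masses[OF _ _ h h_eff]) auto
  have mass_B: "mass B \<theta> b = p \<theta>" "mass B \<theta> b' = 1 - p \<theta>" for \<theta>
    unfolding B_def two_point_model_def
    using mass_model_of_masses[of "{b, b'}" ?h \<theta>, OF _ h] \<open>b \<noteq> b'\<close> by auto
  have space_B: "sample_space B = {b, b'}"
    by (simp add: B_def two_point_model_def)
  have step_B: "cond_step (M, x) (B, b)"
  proof (rule cond_step_event[where F = "{x, z}" and q = "1 / 2"
        and \<iota> = "\<lambda>y. if y = b then x else z"])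
    show "{x, z} \<subset> sample_space M"
      using x w neq by (auto simp: space_M S_def)
    show "prob_of M \<theta> {x, z} = 1 / 2" for \<theta>
      using x neq by (subst prob_M) (auto simp: S_def g_old, simp add: g_def field_simps)
    show "mass B \<theta> y = mass M \<theta> (if y = b then x else z) / (1 / 2)"
      if "y \<in> sample_space B" for \<theta> y
    proof -
      have "mass M \<theta> x = p \<theta> / 2" "mass M \<theta> z = (1 - p \<theta>) / 2"
        using mass_M[of x \<theta>] mass_M[of z \<theta>] x g_old[OF x, of \<theta>]
        by (simp_all add: S_def p_def) (simp add: g_def)
      then show ?thesis
        using that \<open>b \<noteq> b'\<close> by (auto simp: space_B mass_B)
    qed
  qed (use M neq \<open>b \<noteq> b'\<close> in \<open>auto simp: space_B\<close>)

  have "(M, x) \<in> inference_bases" "(B, b) \<in> inference_bases"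
    using M B x by (auto simp: inference_bases_def space_M space_B S_def)
  then have "((M, x), E, x) \<in> conditionality_rel" "((M, x), B, b) \<in> conditionality_rel"
    using base step_E step_B by (auto simp: conditionality_rel_def)
  then show ?thesis
    unfolding B_def p_def by blast
qed

section \<open>Conditionality implies likelihood\<close>

theorem corollary3p1:
  fixes \<A> :: "'a set"
    and Ev :: "(('x, 'th::finite) inference_base \<times> 'a) set"
  assumes universe: "infinite (UNIV :: 'x set)"
    and procedure: "statistical_procedure \<A> Ev"
    and preserves_C: "preserves \<A> Ev conditionality_rel"
  shows "\<forall>(I1, I2) \<in> likelihood_rel - conditionality_rel.
           output_set \<A> Ev I1 = output_set \<A> Ev I2"
proof clarify
  fix E1 E2 :: "('x, 'th) model" and x1 x2
  assume "((E1, x1), E2, x2) \<in> likelihood_rel"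
  then obtain k where bases: "(E1, x1) \<in> inference_bases" "(E2, x2) \<in> inference_bases"
    and "0 < k" and proportional: "\<And>\<theta>. mass E1 \<theta> x1 = k * mass E2 \<theta> x2"
    by (auto simp: likelihood_rel_def)
  obtain b b' :: 'x where "b \<noteq> b'"
    using ex_new_if_finite[OF universe, of "{undefined}"] by auto
  have output_eq: "output_set \<A> Ev I = output_set \<A> Ev J" if "(I, J) \<in> conditionality_rel" for I J
    using preserves_C that by (auto simp: preserves_def)
  have output_two_point: "output_set \<A> Ev (E, x) =
      output_set \<A> Ev (two_point_model b b' (\<lambda>\<theta>. c * mass E \<theta> x), b)"
    if "(E, x) \<in> inference_bases" "0 < c" "c < 1" for E :: "('x, 'th) model" and x c
    using two_point_link[OF universe that \<open>b \<noteq> b'\<close>] output_eq by metis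
  have "(\<lambda>\<theta>. 1 / (1 + k) * mass E1 \<theta> x1) = (\<lambda>\<theta>. k / (1 + k) * mass E2 \<theta> x2)"
    by (simp add: proportional)
  then show "output_set \<A> Ev (E1, x1) = output_set \<A> Ev (E2, x2)"
    using output_two_point[OF bases(1), of "1 / (1 + k)"]
      output_two_point[OF bases(2), of "k / (1 + k)"] \<open>0 < k\<close>
    by simp
qed

end
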